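(* For $n \equiv 2 \pmod 3$, let $X^{id}_n$ be the number of identity-subterms of a closed linear $\lambda$-term of size $n$ drawn uniformly at random (terms taken up to $\alpha$-equivalence). Then, as $n\to\infty$ along $n \equiv 2 \pmod 3$, $X^{id}_n$ converges in distribution to a Poisson random variable of rate $1$.
   Context: $\lambda$-terms are built from variables, applications $(t~u)$ and abstractions $\lambda x.t$. A term is linear if every free or bound variable is used exactly once, and closed if it has no free variables. Size is defined by $|x|=1$, $|(t~u)|=1+|t|+|u|$, $|\lambda x.t|=1+|t|$; closed linear terms exist only in sizes $n\equiv 2 \pmod 3$. The subterms of $t$ are $t$ itself, the subterms of $t_1,t_2$ if $t=(t_1~t_2)$, and the subterms of $u$ if $t=\lambda x.u$; different occurrences of the same subterm are counted separately (the term itself counts). An identity-subterm is a subterm occurrence $\alpha$-equivalent to $\lambda x.x$. Under the known bijection between closed linear terms and rooted trivalent maps, identity-subterms correspond to loops. *)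

theory Defs
  imports "HOL-Probability.Probability"
begin

text \<open>Terms are taken up to alpha-equivalence, so they are represented with de Bruijn indices:
  \<open>Var i\<close> refers to the \<open>i\<close>-th enclosing abstraction, counted from \<open>0\<close> starting with the innermost
  one, and is free if there are at most \<open>i\<close> of them.\<close>

datatype lterm = Var nat | App lterm lterm | Lam lterm

primrec tsize :: "lterm \<Rightarrow> nat" where
  "tsize (Var i) = 1"
| "tsize (App t u) = 1 + tsize t + tsize u"
| "tsize (Lam t) = 1 + tsize t"

text \<open>\<open>occ i t\<close> is the number of occurrences in \<open>t\<close> of its free variable with index \<open>i\<close>
  (as seen from the root of \<open>t\<close>).\<close>

primrec occ :: "nat \<Rightarrow> lterm \<Rightarrow> nat" where
  "occ i (Var j) = (if i = j then 1 else 0)"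
| "occ i (App t u) = occ i t + occ i u"
| "occ i (Lam t) = occ (Suc i) t"

definition free_vars :: "lterm \<Rightarrow> nat set" where
  "free_vars t = {i. occ i t > 0}"

text \<open>A multiset, since different occurrences of the same subterm count separately. The body of an
  abstraction is not shifted, so an index in it may refer outside the subterm; in particular index
  \<open>0\<close> in \<open>u\<close> is the variable bound by \<open>Lam u\<close>.\<close>

primrec subterms :: "lterm \<Rightarrow> lterm multiset" where
  "subterms (Var i) = {#Var i#}"
| "subterms (App t u) = add_mset (App t u) (subterms t + subterms u)"
| "subterms (Lam t) = add_mset (Lam t) (subterms t)"

definition linear_term :: "lterm \<Rightarrow> bool" where
  "linear_term t \<longleftrightarrow>
     (\<forall>i\<in>free_vars t. occ i t = 1) \<and> (\<forall>u. Lam u \<in># subterms t \<longrightarrow> occ 0 u = 1)"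

definition closed_term :: "lterm \<Rightarrow> bool" where
  "closed_term t \<longleftrightarrow> free_vars t = {}"

definition closed_linear_terms :: "nat \<Rightarrow> lterm set" where
  "closed_linear_terms n = {t. closed_term t \<and> linear_term t \<and> tsize t = n}"

text \<open>\<open>Lam (Var 0)\<close> is the alpha-equivalence class of the identity.\<close>

definition id_subterms :: "lterm \<Rightarrow> nat" where
  "id_subterms t = count (subterms t) (Lam (Var 0))"

text \<open>\<open>pmf_of_set\<close> is the uniform distribution only on a finite nonempty set, whence the two facts
  below.\<close>

lemma finite_bounded_terms: "finite {t. tsize t \<le> n \<and> free_vars t \<subseteq> {..<m}}"
proof (induction n arbitrary: m)
  case 0
  have "{t. tsize t \<le> 0 \<and> free_vars t \<subseteq> {..<m}} = {}"
  proof -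
    have "tsize t \<noteq> 0" for t by (cases t) auto
    then show ?thesis by (metis (lifting) Collect_empty_eq le_zero_eq)
  qed
  then show ?case by (metis finite.emptyI)
next
  case (Suc n)
  let ?S = "\<lambda>m. {t. tsize t \<le> n \<and> free_vars t \<subseteq> {..<m}}"
  have "t \<in> Var ` {..<m} \<union> (\<lambda>(t, u). App t u) ` (?S m \<times> ?S m) \<union> Lam ` ?S (Suc m)"
    if t: "tsize t \<le> Suc n" "free_vars t \<subseteq> {..<m}" for t
  proof (cases t)
    case (Var i)
    with t show ?thesis by (auto simp: free_vars_def)
  next
    case (App u v)
    with t have "u \<in> ?S m" "v \<in> ?S m" by (auto simp: free_vars_def)
    with App show ?thesis by auto
  next
    case (Lam u)
    have "i < Suc m" if "occ i u > 0" for i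
      using that t Lam by (cases i) (auto simp: free_vars_def)
    with t Lam have "u \<in> ?S (Suc m)" by (auto simp: free_vars_def)
    with Lam show ?thesis by auto
  qed
  then have "{t. tsize t \<le> Suc n \<and> free_vars t \<subseteq> {..<m}} \<subseteq>
      Var ` {..<m} \<union> (\<lambda>(t, u). App t u) ` (?S m \<times> ?S m) \<union> Lam ` ?S (Suc m)"
    by blast
  then show ?case
    by (rule finite_subset) (intro finite_UnI finite_imageI finite_cartesian_product Suc.IH finite_lessThan)
qed

lemma finite_closed_linear_terms: "finite (closed_linear_terms n)"
  by (rule finite_subset[OF _ finite_bounded_terms[of n 0]])
     (auto simp: closed_linear_terms_def closed_term_def)

lemma closed_linear_terms_nonempty: "closed_linear_terms (3 * k + 2) \<noteq> {}"
proof (induction k)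
  case 0
  have "Lam (Var 0) \<in> closed_linear_terms 2"
    by (auto simp: closed_linear_terms_def closed_term_def linear_term_def free_vars_def)
  then show ?case by (auto simp: numeral_2_eq_2)
next
  case (Suc k)
  then obtain t where "t \<in> closed_linear_terms (3 * k + 2)" by blast
  then have "App t (Lam (Var 0)) \<in> closed_linear_terms (3 * Suc k + 2)"
    by (auto simp: closed_linear_terms_def closed_term_def linear_term_def free_vars_def)
  then show ?case by blast
qed

end

theory Submission
  imports Defs "HOL-Computational_Algebra.Formal_Power_Series" "HOL-Computational_Algebra.Polynomial"
    "HOL-Real_Asymp.Real_Asymp"
begin

text \<open>A linear term with one extra free variable \<open>x\<close> is \<open>x\<close> itself or is obtained by choosing one of the \<open>n\<close>
  subterms \<open>s\<close> of a linear term and replacing it by \<open>x s\<close> or \<open>s x\<close>. Instead of constructing this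
  bijection, it is read off the generating functions \<open>W A\<close> of linear terms with free variables
  \<open>A\<close>: with \<open>X\<close> marking size and \<open>1 + v\<close> marking identity-subterms, both sides of
  \<open>W (A \<union> {x}) = [A = {}] X + 2 X\<^sup>2 \<Delta> (W A)\<close>, where \<open>\<Delta>\<close> is the derivation
  \<open>X \<partial>/\<partial>X - v \<partial>/\<partial>v\<close>, satisfy the same recursive equation. Applied to \<open>A = {}\<close>, this is a
  recurrence in \<open>k\<close> for the factorial moments \<open>F(k, r)\<close> (binomial sums over the closed linear
  terms of size \<open>3 k + 2\<close>). Up to negligible convolution terms it reads
  \<open>F(k + 1, r) = (6 k + 6 - 2 r) F(k, r) + 2 F(k, r - 1)\<close>, so \<open>F(k, r) / F(k, 0)\<close> is driven to the
  fixed point \<open>1 / r!\<close>, the factorial moment of the Poisson law of rate \<open>1\<close>. Since the Newton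
  expansion of \<open>(1 + w) ^ m\<close> has its remainder bounded by the next term when \<open>|1 + w| \<le> 1\<close>, the
  characteristic functions converge.\<close>

section \<open>Generating functions of linear terms\<close>

lemma free_vars_Var: "free_vars (Var i) = {i}"
  by (auto simp: free_vars_def)

lemma free_vars_App: "free_vars (App t u) = free_vars t \<union> free_vars u"
  by (auto simp: free_vars_def)

lemma free_vars_Lam: "free_vars (Lam t) = {i. Suc i \<in> free_vars t}"
  by (auto simp: free_vars_def)

lemma linear_term_Var: "linear_term (Var i)"
  by (auto simp: linear_term_def free_vars_def)

lemma linear_term_App:
  "linear_term (App t u) \<longleftrightarrow> linear_term t \<and> linear_term u \<and> free_vars t \<inter> free_vars u = {}"
proof -
  have "(\<forall>i\<in>free_vars (App t u). occ i (App t u) = 1) \<longleftrightarrow>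
      (\<forall>i\<in>free_vars t. occ i t = 1) \<and> (\<forall>i\<in>free_vars u. occ i u = 1) \<and> free_vars t \<inter> free_vars u = {}"
    (is "?L \<longleftrightarrow> ?R")
  proof
    assume L: ?L
    have "occ i t + occ i u \<le> 1" for i
      using L by (cases "occ i t + occ i u = 0") (auto simp: free_vars_def)
    moreover have "occ i t = 1" if "occ i t > 0" "occ i t + occ i u \<le> 1" for i
      using that by linarith
    moreover have "occ i u = 1" if "occ i u > 0" "occ i t + occ i u \<le> 1" for i
      using that by linarith
    moreover have False if "occ i t > 0" "occ i u > 0" "occ i t + occ i u \<le> 1" for i
      using that by linarith
    ultimately show ?R unfolding free_vars_def by blast
  next
    assume R: ?R
    show ?L
    proof
      fix i assume "i \<in> free_vars (App t u)"
      then have "occ i t > 0 \<or> occ i u > 0" by (auto simp: free_vars_def)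
      moreover have "occ i t = 0 \<or> occ i u = 0" using R by (auto simp: free_vars_def)
      moreover have "occ i t > 0 \<longrightarrow> occ i t = 1" "occ i u > 0 \<longrightarrow> occ i u = 1"
        using R by (simp_all add: free_vars_def)
      ultimately show "occ i (App t u) = 1" by auto
    qed
  qed
  then show ?thesis by (auto simp: linear_term_def)
qed

lemma linear_term_Lam: "linear_term (Lam t) \<longleftrightarrow> linear_term t \<and> 0 \<in> free_vars t"
proof -
  have "(\<forall>i\<in>free_vars (Lam t). occ i (Lam t) = 1) \<and> occ 0 t = 1 \<longleftrightarrow>
      (\<forall>i\<in>free_vars t. occ i t = 1) \<and> 0 \<in> free_vars t" (is "?L \<longleftrightarrow> ?R")
  proof
    assume L: ?L
    have "occ i t = 1" if "occ i t > 0" for i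
      using that L by (cases i) (auto simp: free_vars_def)
    with L show ?R by (auto simp: free_vars_def)
  next
    assume ?R
    then show ?L by (auto simp: free_vars_def)
  qed
  then show ?thesis by (auto simp: linear_term_def)
qed

text \<open>The exact set of free variables is the index, since an application splits it between its
  two sides and an abstraction shifts it and adds \<open>0\<close>.\<close>

definition linear_terms :: "nat \<Rightarrow> nat set \<Rightarrow> lterm set" where
  "linear_terms n A = {t. linear_term t \<and> free_vars t = A \<and> tsize t = n}"

lemma closed_linear_terms_eq: "closed_linear_terms n = linear_terms n {}"
  by (auto simp: closed_linear_terms_def linear_terms_def closed_term_def)

lemma finite_linear_terms: "finite A \<Longrightarrow> finite (linear_terms n A)"
proof -
  assume "finite A"
  then obtain m where "A \<subseteq> {..<m}" using finite_nat_iff_bounded by blast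
  then show ?thesis
    by (intro finite_subset[OF _ finite_bounded_terms[of n m]]) (auto simp: linear_terms_def)
qed

lemma linear_terms_0: "linear_terms 0 A = {}"
proof -
  have "tsize t \<noteq> 0" for t by (cases t) auto
  then show ?thesis by (auto simp: linear_terms_def)
qed

lemma pred_set_eq_iff: "0 \<in> B \<and> {i. Suc i \<in> B} = A \<longleftrightarrow> B = insert 0 (Suc ` A)" (is "?L \<longleftrightarrow> ?R")
proof
  assume L: ?L
  show ?R
  proof (rule set_eqI)
    fix i show "i \<in> B \<longleftrightarrow> i \<in> insert 0 (Suc ` A)" using L by (cases i) auto
  qed
qed auto

text \<open>The left side of an application determines \<open>B\<close> and \<open>i\<close>, so the
  indexing yields each application exactly once.\<close>

lemma linear_terms_Suc:
  "linear_terms (Suc n) A =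
     Var ` {i. n = 0 \<and> A = {i}} \<union>
     (\<lambda>(B, i, t, u). App t u) `
       (SIGMA B:Pow A. SIGMA i:{..n}. linear_terms i B \<times> linear_terms (n - i) (A - B)) \<union>
     Lam ` linear_terms n (insert 0 (Suc ` A))" (is "?L = ?V \<union> ?A \<union> ?F")
proof -
  have "t \<in> ?L \<longleftrightarrow> t \<in> ?V \<union> ?A \<union> ?F" for t
  proof (cases t)
    case (Var i)
    then show ?thesis
      by (auto simp: linear_terms_def free_vars_Var linear_term_Var)
  next
    case (App u v)
    have "t \<in> ?L \<longleftrightarrow> (free_vars u, tsize u, u, v) \<in>
       (SIGMA B:Pow A. SIGMA i:{..n}. linear_terms i B \<times> linear_terms (n - i) (A - B))"
      using App by (auto simp: linear_terms_def free_vars_App linear_term_App)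
    also have "\<dots> \<longleftrightarrow> t \<in> ?A"
      using App by (auto simp: linear_terms_def image_iff)
    also have "\<dots> \<longleftrightarrow> t \<in> ?V \<union> ?A \<union> ?F"
    proof -
      have "t \<notin> ?V" "t \<notin> ?F" using App by auto
      then show ?thesis by blast
    qed
    finally show ?thesis .
  next
    case (Lam u)
    have "t \<in> ?L \<longleftrightarrow> u \<in> linear_terms n (insert 0 (Suc ` A))"
      using Lam pred_set_eq_iff[of "free_vars u" A]
      by (auto simp: linear_terms_def free_vars_Lam linear_term_Lam)
    also have "\<dots> \<longleftrightarrow> t \<in> ?V \<union> ?A \<union> ?F" using Lam by auto
    finally show ?thesis .
  qed
  then show ?thesis by blast
qed

section \<open>Enumeration weighted by identity-subterms\<close>

text \<open>Powers of \<open>1 + v\<close> rather than of \<open>v\<close> make the coefficients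
  binomial moments, while the weight stays multiplicative over applications.\<close>

definition id_weight :: "lterm \<Rightarrow> real poly" where
  "id_weight t = [:1, 1:] ^ id_subterms t"

lemma id_weight_Var: "id_weight (Var i) = 1"
  by (simp add: id_weight_def id_subterms_def)

lemma id_weight_App: "id_weight (App t u) = id_weight t * id_weight u"
  by (simp add: id_weight_def id_subterms_def power_add)

text \<open>Only an abstraction over \<open>Var 0\<close> creates an identity-subterm; the weight
  then rises from \<open>1\<close> to \<open>1 + v\<close>, so the correction is additive.\<close>

lemma id_weight_Lam: "id_weight (Lam t) = id_weight t + (if t = Var 0 then [:0, 1:] else 0)"
  by (auto simp: id_weight_def id_subterms_def one_pCons)

definition linear_gf :: "nat set \<Rightarrow> real poly fps" where
  "linear_gf A = Abs_fps (\<lambda>n. \<Sum>t\<in>linear_terms n A. id_weight t)"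

lemma sum_id_weight_Suc:
  assumes "finite A"
  shows "(\<Sum>t\<in>linear_terms (Suc n) A. id_weight t) =
    (if n = 0 \<and> card A = 1 then 1 else 0) +
    (\<Sum>B\<in>Pow A. \<Sum>i\<le>n. (\<Sum>t\<in>linear_terms i B. id_weight t) * (\<Sum>t\<in>linear_terms (n - i) (A - B). id_weight t)) +
    (\<Sum>t\<in>linear_terms n (insert 0 (Suc ` A)). id_weight t) +
    (if n = 1 \<and> A = {} then [:0, 1:] else 0)"
proof -
  let ?S = "SIGMA B:Pow A. SIGMA i:{..n}. linear_terms i B \<times> linear_terms (n - i) (A - B)"
  let ?V = "{i. n = 0 \<and> A = {i}}"
  let ?F = "linear_terms n (insert 0 (Suc ` A))"
  let ?f = "\<lambda>(B :: nat set, i :: nat, t, u). App t u"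
  have finS: "finite ?S"
    using assms by (intro finite_SigmaI finite_linear_terms) (auto intro: finite_subset)
  have finV: "finite ?V"
    by (rule finite_subset[OF _ assms]) auto
  have finF: "finite ?F" using assms by (intro finite_linear_terms) auto
  have inj: "inj_on ?f ?S"
    by (auto simp: inj_on_def linear_terms_def)
  have V: "(\<Sum>t\<in>Var ` ?V. id_weight t) = (if n = 0 \<and> card A = 1 then 1 else 0)"
  proof (cases "n = 0 \<and> card A = 1")
    case True
    then obtain i where "A = {i}" by (auto simp: card_1_singleton_iff)
    with True have "?V = {i}" by auto
    then show ?thesis using True by (simp add: id_weight_Var)
  next
    case False
    then have "?V = {}" by auto
    then show ?thesis using False by auto
  qed
  have A: "(\<Sum>t\<in>?f ` ?S. id_weight t) = (\<Sum>B\<in>Pow A. \<Sum>i\<le>n.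
      (\<Sum>t\<in>linear_terms i B. id_weight t) * (\<Sum>t\<in>linear_terms (n - i) (A - B). id_weight t))"
  proof -
    have "(\<Sum>t\<in>?f ` ?S. id_weight t) = (\<Sum>(B, i, t, u)\<in>?S. id_weight t * id_weight u)"
      by (subst sum.reindex[OF inj]) (auto intro!: sum.cong simp: id_weight_App)
    also have "\<dots> = (\<Sum>B\<in>Pow A. \<Sum>(i, t, u)\<in>(SIGMA i:{..n}. linear_terms i B \<times> linear_terms (n - i) (A - B)).
         id_weight t * id_weight u)"
      using assms by (subst sum.Sigma)
       (auto intro!: finite_SigmaI finite_linear_terms intro: finite_subset)
    also have "\<dots> = (\<Sum>B\<in>Pow A. \<Sum>i\<le>n. \<Sum>(t, u)\<in>linear_terms i B \<times> linear_terms (n - i) (A - B).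
         id_weight t * id_weight u)"
      using assms by (intro sum.cong refl, subst sum.Sigma)
       (auto intro!: finite_SigmaI finite_linear_terms intro: finite_subset)
    also have "\<dots> = (\<Sum>B\<in>Pow A. \<Sum>i\<le>n.
      (\<Sum>t\<in>linear_terms i B. id_weight t) * (\<Sum>t\<in>linear_terms (n - i) (A - B). id_weight t))"
      by (simp add: sum_product sum.cartesian_product)
    finally show ?thesis .
  qed
  have F: "(\<Sum>t\<in>Lam ` ?F. id_weight t) = (\<Sum>t\<in>?F. id_weight t) + (if n = 1 \<and> A = {} then [:0, 1:] else 0)"
  proof -
    have mem: "Var 0 \<in> ?F \<longleftrightarrow> n = 1 \<and> A = {}"
      by (auto simp: linear_terms_def linear_term_Var free_vars_Var)
    have "(\<Sum>t\<in>Lam ` ?F. id_weight t) = (\<Sum>t\<in>?F. id_weight t + (if t = Var 0 then [:0, 1:] else 0))"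
      by (subst sum.reindex) (auto simp: inj_on_def id_weight_Lam)
    also have "\<dots> = (\<Sum>t\<in>?F. id_weight t) + (if n = 1 \<and> A = {} then [:0, 1:] else 0)"
      using mem finF by (simp add: sum.distrib sum.delta)
    finally show ?thesis .
  qed
  have "(\<Sum>t\<in>linear_terms (Suc n) A. id_weight t) =
      (\<Sum>t\<in>Var ` ?V. id_weight t) + (\<Sum>t\<in>?f ` ?S. id_weight t) + (\<Sum>t\<in>Lam ` ?F. id_weight t)"
    unfolding linear_terms_Suc using finS finV finF
    by (subst sum.union_disjoint; (subst sum.union_disjoint)?) auto
  then show ?thesis unfolding V A F by (simp add: add.assoc)
qed

lemma linear_gf_eq:
  assumes "finite A"
  shows "linear_gf A = fps_X * ((if card A = 1 then 1 else 0) +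
     (\<Sum>B\<in>Pow A. linear_gf B * linear_gf (A - B)) + linear_gf (insert 0 (Suc ` A)) +
     (if A = {} then fps_const [:0, 1:] * fps_X else 0))"
proof (rule fps_ext)
  fix n
  show "fps_nth (linear_gf A) n = fps_nth (fps_X * ((if card A = 1 then 1 else 0) +
     (\<Sum>B\<in>Pow A. linear_gf B * linear_gf (A - B)) + linear_gf (insert 0 (Suc ` A)) +
     (if A = {} then fps_const [:0, 1:] * fps_X else 0))) n"
  proof (cases n)
    case 0
    then show ?thesis by (simp add: linear_gf_def linear_terms_0)
  next
    case (Suc m)
    have "fps_nth (linear_gf B * linear_gf C) m = (\<Sum>i\<le>m. (\<Sum>t\<in>linear_terms i B. id_weight t) *
        (\<Sum>t\<in>linear_terms (m - i) C. id_weight t))" for B C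
      by (simp add: linear_gf_def fps_mult_nth atLeast0AtMost)
    moreover have "fps_nth (linear_gf B) i = (\<Sum>t\<in>linear_terms i B. id_weight t)" for B i
      by (simp add: linear_gf_def)
    ultimately show ?thesis
      using sum_id_weight_Suc[OF assms, of m] Suc
      by (simp add: fps_sum_nth fps_X_nth)
  qed
qed

section \<open>Inserting a variable\<close>

text \<open>A derivation that multiplies the coefficient of \<open>X^n v^r\<close> by \<open>n - r\<close>, where \<open>v\<close> is the
  polynomial variable.\<close>

definition grade_deriv :: "real poly fps \<Rightarrow> real poly fps" where
  "grade_deriv F = Abs_fps (\<lambda>n. of_nat n * fps_nth F n - [:0, 1:] * pderiv (fps_nth F n))"

lemma grade_deriv_add: "grade_deriv (F + G) = grade_deriv F + grade_deriv G"
  by (rule fps_ext) (simp add: grade_deriv_def pderiv_add ring_distribs)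

lemma grade_deriv_0: "grade_deriv 0 = 0"
  by (simp add: grade_deriv_def fps_eq_iff)

lemma grade_deriv_sum: "grade_deriv (sum f S) = (\<Sum>x\<in>S. grade_deriv (f x))"
  by (induction S rule: infinite_finite_induct) (simp_all add: grade_deriv_add grade_deriv_0)

lemma grade_deriv_1: "grade_deriv 1 = 0"
  by (simp add: grade_deriv_def fps_eq_iff)

lemma grade_deriv_X: "grade_deriv fps_X = fps_X"
  by (simp add: grade_deriv_def fps_eq_iff fps_X_nth)

lemma grade_deriv_const_X: "grade_deriv (fps_const [:0, 1:] * fps_X) = 0"
proof (rule fps_ext)
  fix n
  show "fps_nth (grade_deriv (fps_const [:0, 1:] * fps_X)) n = fps_nth 0 n"
    by (cases "n = 1") (auto simp: grade_deriv_def fps_X_nth pderiv_pCons)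
qed

lemma pderiv_sum: "pderiv (sum f S) = (\<Sum>x\<in>S. pderiv (f x))"
  for f :: "'b \<Rightarrow> real poly"
  by (induction S rule: infinite_finite_induct) (simp_all add: pderiv_add)

lemma grade_deriv_mult: "grade_deriv (F * G) = grade_deriv F * G + F * grade_deriv G"
proof (rule fps_ext)
  fix n
  have leibniz: "(a + b) * (p * q) - v * (p * q' + q * p') = (a * p - v * p') * q + p * (b * q - v * q')"
    for a b p q p' q' v :: "real poly"
    by (simp add: algebra_simps)
  have "fps_nth (grade_deriv (F * G)) n =
    (\<Sum>i\<in>{0..n}. of_nat n * (fps_nth F i * fps_nth G (n - i)) -
       [:0, 1:] * pderiv (fps_nth F i * fps_nth G (n - i)))"
    unfolding grade_deriv_def fps_mult_nth fps_nth_Abs_fps sum_subtractf pderiv_sum sum_distrib_left ..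
  also have "\<dots> = (\<Sum>i\<in>{0..n}.
     (of_nat i * fps_nth F i - [:0, 1:] * pderiv (fps_nth F i)) * fps_nth G (n - i) +
     fps_nth F i * (of_nat (n - i) * fps_nth G (n - i) - [:0, 1:] * pderiv (fps_nth G (n - i))))"
  proof (rule sum.cong[OF refl])
    fix i assume "i \<in> {0..n}"
    then have n: "of_nat n = (of_nat i + of_nat (n - i) :: real poly)"
      by (simp flip: of_nat_add)
    show "of_nat n * (fps_nth F i * fps_nth G (n - i)) - [:0, 1:] * pderiv (fps_nth F i * fps_nth G (n - i)) =
      (of_nat i * fps_nth F i - [:0, 1:] * pderiv (fps_nth F i)) * fps_nth G (n - i) +
      fps_nth F i * (of_nat (n - i) * fps_nth G (n - i) - [:0, 1:] * pderiv (fps_nth G (n - i)))"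
      unfolding pderiv_mult n by (rule leibniz)
  qed
  also have "\<dots> = fps_nth (grade_deriv F * G + F * grade_deriv G) n"
    unfolding grade_deriv_def fps_mult_nth fps_nth_Abs_fps fps_add_nth sum.distrib ..
  finally show "fps_nth (grade_deriv (F * G)) n = fps_nth (grade_deriv F * G + F * grade_deriv G) n" .
qed

text \<open>The error of the insertion formula. In a term of size \<open>n\<close> with
  \<open>j\<close> identity-subterms, inserting \<open>x\<close> destroys an identity at
  \<open>j\<close> positions, the variables bound by the identities, and none at the other
  \<open>n - j\<close>. With \<open>p = (1 + v)^j\<close> the weights sum to
  \<open>(n - j) (1 + v)^j + j (1 + v)^(j - 1) = n p - v p'\<close>. The factor \<open>2 X^2\<close>
  stands for the side of \<open>x\<close> and the two new nodes.\<close>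

definition insert_defect :: "nat \<Rightarrow> nat set \<Rightarrow> real poly fps" where
  "insert_defect x A = linear_gf (insert x A) - (if A = {} then fps_X else 0) -
     2 * fps_X ^ 2 * grade_deriv (linear_gf A)"

lemma sum_Pow_insert:
  assumes "finite A" "x \<notin> A"
  shows "(\<Sum>B\<in>Pow (insert x A). f B) = (\<Sum>B\<in>Pow A. f B + f (insert x B))"
proof -
  have "inj_on (insert x) (Pow A)" using assms by (auto simp: inj_on_def)
  moreover have "Pow A \<inter> insert x ` Pow A = {}" using assms by auto
  moreover have "finite (Pow A)" using assms by simp
  ultimately show ?thesis
    unfolding Pow_insert by (simp add: sum.union_disjoint sum.reindex sum.distrib)
qed

lemma sum_Pow_complement: "(\<Sum>B\<in>Pow A. f B (A - B)) = (\<Sum>B\<in>Pow A. f (A - B) B)"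
  by (rule sum.reindex_bij_witness[of _ "\<lambda>B. A - B" "\<lambda>B. A - B"]) (auto simp: double_diff)

text \<open>Since the derivation satisfies the Leibniz rule, the functional equations of
  \<open>linear_gf (insert x A)\<close> and of \<open>linear_gf A\<close> make the defect satisfy a homogeneous equation.\<close>

lemma insert_defect_eq:
  assumes "finite A" "x \<notin> A"
  shows "insert_defect x A = fps_X * (2 * (\<Sum>B\<in>Pow A. linear_gf B * insert_defect x (A - B)) +
     insert_defect (Suc x) (insert 0 (Suc ` A)))"
proof -
  let ?A' = "insert 0 (Suc ` A)" and ?W = linear_gf and ?X = "fps_X :: real poly fps"
  let ?S = "\<Sum>B\<in>Pow A. ?W B * ?W (A - B)" and ?D = "\<Sum>B\<in>Pow A. ?W B * grade_deriv (?W (A - B))"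
  let ?E = "\<Sum>B\<in>Pow A. ?W B * insert_defect x (A - B)"
  define c where "c = (if card A = 1 then 1 else 0 :: real poly fps)"
  define v where "v = (if A = {} then fps_const [:0, 1:] * ?X else 0)"
  define e where "e = (if A = {} then 1 else 0 :: real poly fps)"
  have W: "?W A = ?X * (c + ?S + ?W ?A' + v)"
    using linear_gf_eq[OF assms(1)] by (simp add: c_def v_def)
  have gc: "grade_deriv c = 0" and gv: "grade_deriv v = 0"
    by (auto simp: c_def v_def grade_deriv_1 grade_deriv_0 grade_deriv_const_X)
  \<comment> \<open>Exchanging \<open>B\<close> with its complement identifies the two Leibniz
    summands.\<close>
  have gS: "grade_deriv ?S = 2 * ?D"
  proof -
    have "grade_deriv ?S = (\<Sum>B\<in>Pow A. grade_deriv (?W B) * ?W (A - B)) + ?D"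
      by (simp add: grade_deriv_sum grade_deriv_mult sum.distrib)
    also have "(\<Sum>B\<in>Pow A. grade_deriv (?W B) * ?W (A - B)) = (\<Sum>B\<in>Pow A. grade_deriv (?W (A - B)) * ?W B)"
      by (rule sum_Pow_complement)
    also have "\<dots> = ?D" by (simp add: mult.commute)
    finally show ?thesis by simp
  qed
  have gW: "grade_deriv (?W A) = ?W A + ?X * (2 * ?D + grade_deriv (?W ?A'))"
  proof -
    let ?R = "c + ?S + ?W ?A' + v"
    have "grade_deriv (?X * ?R) = ?X * ?R + ?X * (2 * ?D + grade_deriv (?W ?A'))"
      by (simp only: grade_deriv_mult grade_deriv_add grade_deriv_X gc gv gS) simp
    then show ?thesis by (simp only: W[symmetric])
  qed
  have card: "(if card (insert x A) = 1 then 1 else 0) = e"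
    using assms by (simp add: e_def card_insert_if)
  have W_insert: "?W (insert x B) = insert_defect x B + (if B = {} then ?X else 0) + 2 * ?X ^ 2 * grade_deriv (?W B)" for B
    by (simp add: insert_defect_def)
  \<comment> \<open>Either side of the application may receive \<open>x\<close>; complementing
    \<open>B\<close> makes the two cases equal, whence the factor \<open>2\<close>.\<close>
  have "(\<Sum>B\<in>Pow (insert x A). ?W B * ?W (insert x A - B)) =
     (\<Sum>B\<in>Pow A. ?W B * ?W (insert x A - B)) + (\<Sum>B\<in>Pow A. ?W (insert x B) * ?W (insert x A - insert x B))"
    by (simp only: sum_Pow_insert[OF assms] sum.distrib)
  also have "(\<Sum>B\<in>Pow A. ?W B * ?W (insert x A - B)) = (\<Sum>B\<in>Pow A. ?W B * ?W (insert x (A - B)))"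
    using assms by (intro sum.cong refl arg_cong2[where f = "(*)"] arg_cong[where f = ?W]) auto
  also have "(\<Sum>B\<in>Pow A. ?W (insert x B) * ?W (insert x A - insert x B)) = (\<Sum>B\<in>Pow A. ?W (insert x B) * ?W (A - B))"
    using assms by (intro sum.cong refl arg_cong2[where f = "(*)"] arg_cong[where f = ?W]) auto
  also have "\<dots> = (\<Sum>B\<in>Pow A. ?W (insert x (A - B)) * ?W B)"
    by (rule sum_Pow_complement)
  also have "\<dots> = (\<Sum>B\<in>Pow A. ?W B * ?W (insert x (A - B)))"
    by (simp add: mult.commute)
  also have "\<dots> = ?E + (\<Sum>B\<in>Pow A. ?W B * (if A - B = {} then ?X else 0)) + 2 * ?X ^ 2 * ?D"
    unfolding W_insert by (simp add: sum.distrib sum_distrib_left algebra_simps)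
  also have "(\<Sum>B\<in>Pow A. ?W B * (if A - B = {} then ?X else 0)) = (\<Sum>B\<in>Pow A. if B = A then ?W A * ?X else 0)"
    by (rule sum.cong) auto
  also have "\<dots> = ?W A * ?X" using assms by (simp add: sum.delta)
  finally have S_insert: "(\<Sum>B\<in>Pow (insert x A). ?W B * ?W (insert x A - B)) =
     2 * (?E + ?W A * ?X + 2 * ?X ^ 2 * ?D)" by simp
  \<comment> \<open>Under the binder \<open>x\<close> and \<open>A\<close> become
    \<open>Suc x\<close> and \<open>?A'\<close>. The identity correction is absent because
    \<open>insert x A\<close> is nonempty.\<close>
  have "?W (insert x A) = ?X * (e + 2 * (?E + ?W A * ?X + 2 * ?X ^ 2 * ?D) + ?W (insert (Suc x) ?A'))"
    using linear_gf_eq[of "insert x A"] assms card S_insert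
    by (simp add: insert_commute)
  moreover have "?W (insert (Suc x) ?A') = insert_defect (Suc x) ?A' + 2 * ?X ^ 2 * grade_deriv (?W ?A')"
    by (simp add: insert_defect_def)
  moreover have "insert_defect x A = ?W (insert x A) - ?X * e - 2 * ?X ^ 2 * grade_deriv (?W A)"
    by (simp add: insert_defect_def e_def)
  ultimately show ?thesis
    unfolding gW by (simp add: algebra_simps power2_eq_square)
qed

text \<open>The prefactor \<open>fps_X\<close> makes each coefficient depend on earlier ones only.
  Since the abstraction enlarges the variable set, the induction runs over all \<open>x\<close> and
  \<open>A\<close> at once.\<close>

lemma insert_defect_nth: "finite A \<Longrightarrow> x \<notin> A \<Longrightarrow> fps_nth (insert_defect x A) n = 0"
proof (induction n arbitrary: x A rule: less_induct)
  case (less n)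
  show ?case
  proof (cases n)
    case 0
    then show ?thesis by (subst insert_defect_eq[OF less.prems]) simp
  next
    case (Suc m)
    have "fps_nth (insert_defect x (A - B)) i = 0" if "i \<le> m" for B i
      using less.prems Suc that by (intro less.IH) auto
    then have "fps_nth (\<Sum>B\<in>Pow A. linear_gf B * insert_defect x (A - B)) m = 0"
      by (simp add: fps_mult_nth fps_sum_nth)
    moreover have "fps_nth (insert_defect (Suc x) (insert 0 (Suc ` A))) m = 0"
      using less.prems Suc by (intro less.IH) auto
    ultimately have "fps_nth (fps_X * (2 * (\<Sum>B\<in>Pow A. linear_gf B * insert_defect x (A - B)) +
       insert_defect (Suc x) (insert 0 (Suc ` A)))) n = 0"
      unfolding Suc mult_2 by (simp only: fps_X_mult_nth fps_add_nth) simp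
    then show ?thesis by (simp only: insert_defect_eq[OF less.prems])
  qed
qed

lemma linear_gf_insert:
  assumes "finite A" "x \<notin> A"
  shows "linear_gf (insert x A) = (if A = {} then fps_X else 0) + 2 * fps_X ^ 2 * grade_deriv (linear_gf A)"
proof -
  have "insert_defect x A = 0"
    using insert_defect_nth[OF assms] by (simp add: fps_eq_iff)
  then show ?thesis by (simp add: insert_defect_def algebra_simps)
qed

text \<open>The body of a closed abstraction has the single free variable \<open>0\<close>, so the
  insertion formula collapses the infinite system to one equation.\<close>

lemma closed_gf_eq:
  "linear_gf {} = fps_X * (linear_gf {} ^ 2 + fps_X + 2 * fps_X ^ 2 * grade_deriv (linear_gf {}) +
     fps_const [:0, 1:] * fps_X)"
proof -
  let ?T = "linear_gf {}"
  have T_sq: "(\<Sum>B\<in>Pow {}. linear_gf B * linear_gf ({} - B)) = ?T ^ 2"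
    by (simp add: power2_eq_square)
  have T_Lam: "linear_gf (insert 0 (Suc ` {})) = fps_X + 2 * fps_X ^ 2 * grade_deriv ?T"
    using linear_gf_insert[of "{}" 0] by (simp only: image_empty finite.emptyI empty_iff if_True refl simp_thms)
  have "?T = fps_X * ((if card ({} :: nat set) = 1 then 1 else 0) +
     (\<Sum>B\<in>Pow {}. linear_gf B * linear_gf ({} - B)) + linear_gf (insert 0 (Suc ` {})) +
     (if {} = ({} :: nat set) then fps_const [:0, 1:] * fps_X else 0))"
    by (rule linear_gf_eq) simp
  also have "\<dots> = fps_X * (?T ^ 2 + fps_X + 2 * fps_X ^ 2 * grade_deriv ?T + fps_const [:0, 1:] * fps_X)"
    unfolding T_sq T_Lam by simp
  finally show ?thesis .
qed

section \<open>Factorial moments\<close>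

lemma coeff_id_weight: "coeff (id_weight t) r = real (id_subterms t choose r)"
proof -
  have "coeff ([:1, 1:] ^ m) r = real (m choose r)" for m
  proof (cases "r \<le> m")
    case False
    have "degree ([:1, 1 :: real:] ^ m) = m" by (simp add: degree_power_eq)
    with False show ?thesis by (simp add: coeff_eq_0)
  qed (simp add: coeff_linear_poly_power)
  then show ?thesis by (simp add: id_weight_def)
qed

lemma closed_gf_nth_Suc:
  "fps_nth (linear_gf {}) (Suc n) =
     (\<Sum>i\<le>n. fps_nth (linear_gf {}) i * fps_nth (linear_gf {}) (n - i)) + (if n = 1 then [:1, 1:] else 0) +
     (if n < 2 then 0 else 2 * fps_nth (grade_deriv (linear_gf {})) (n - 2))"
proof -
  let ?T = "linear_gf {}"
  have "fps_nth ?T (Suc n) = fps_nth (fps_X * (?T ^ 2 + fps_X + 2 * fps_X ^ 2 * grade_deriv ?T +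
     fps_const [:0, 1:] * fps_X)) (Suc n)"
    using closed_gf_eq by (rule arg_cong)
  also have "\<dots> = fps_nth (?T ^ 2) n + (fps_nth fps_X n + fps_nth (fps_const [:0, 1:] * fps_X) n) +
     fps_nth (fps_X ^ 2 * (2 * grade_deriv ?T)) n"
    by (simp add: mult_ac add_ac)
  also have "fps_nth (?T ^ 2) n = (\<Sum>i\<le>n. fps_nth ?T i * fps_nth ?T (n - i))"
    by (simp add: power2_eq_square fps_mult_nth atLeast0AtMost)
  also have "fps_nth fps_X n + fps_nth (fps_const [:0, 1:] * fps_X) n = (if n = 1 then [:1, 1:] else 0 :: real poly)"
    by (simp add: fps_X_nth one_pCons)
  also have "fps_nth (fps_X ^ 2 * (2 * grade_deriv ?T)) n =
     (if n < 2 then 0 else 2 * fps_nth (grade_deriv ?T) (n - 2))"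
    by (simp only: fps_X_power_mult_nth mult_2 fps_add_nth)
  finally show ?thesis .
qed

text \<open>Both steps preserve the residue: an application has size \<open>2 + 2 + 1\<close> modulo
  3, and an abstraction obtained by insertion adds 3.\<close>

lemma closed_gf_nth_eq_0: "n mod 3 \<noteq> 2 \<Longrightarrow> fps_nth (linear_gf {}) n = 0"
proof (induction n rule: less_induct)
  case (less n)
  show ?case
  proof (cases n)
    case 0
    then show ?thesis by (simp add: linear_gf_def linear_terms_0)
  next
    case (Suc m)
    have "(\<Sum>i\<le>m. fps_nth (linear_gf {}) i * fps_nth (linear_gf {}) (m - i)) = 0"
    proof (intro sum.neutral ballI)
      fix i assume "i \<in> {..m}"
      then have that: "i \<le> m" by simp
      have "Suc m mod 3 = 2" if "i mod 3 = 2" "j mod 3 = 2" "m = i + j" for j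
        using that by presburger
      moreover have "m = i + (m - i)" using that by simp
      ultimately have "i mod 3 \<noteq> 2 \<or> (m - i) mod 3 \<noteq> 2"
        using less.prems Suc by blast
      moreover have "i < n" "m - i < n" using that Suc by auto
      ultimately have "fps_nth (linear_gf {}) i = 0 \<or> fps_nth (linear_gf {}) (m - i) = 0"
        using less.IH by blast
      then show "fps_nth (linear_gf {}) i * fps_nth (linear_gf {}) (m - i) = 0" by auto
    qed
    moreover have "fps_nth (grade_deriv (linear_gf {})) (m - 2) = 0" if "\<not> m < 2"
    proof -
      have "Suc m = (m - 2) + 3" using that by simp
      then have "(m - 2) mod 3 \<noteq> 2" using less.prems Suc by (metis mod_add_self2)
      then have "fps_nth (linear_gf {}) (m - 2) = 0" using Suc by (intro less.IH) auto
      then show ?thesis by (simp add: grade_deriv_def)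
    qed
    moreover have "m \<noteq> 1" using less.prems Suc by auto
    ultimately show ?thesis
      unfolding Suc closed_gf_nth_Suc by simp
  qed
qed

text \<open>The unnormalised binomial moment; \<open>r = 0\<close> gives the number of
  terms.\<close>

definition id_moment :: "nat \<Rightarrow> nat \<Rightarrow> real" where
  "id_moment k r = (\<Sum>t\<in>closed_linear_terms (3 * k + 2). real (id_subterms t choose r))"

lemma coeff_closed_gf: "coeff (fps_nth (linear_gf {}) (3 * k + 2)) r = id_moment k r"
  by (simp add: id_moment_def linear_gf_def coeff_sum coeff_id_weight closed_linear_terms_eq)

lemma id_moment_nonneg: "id_moment k r \<ge> 0"
  by (simp add: id_moment_def sum_nonneg)

lemma id_moment_0: "id_moment 0 r = (if r \<le> 1 then 1 else 0)"
proof -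
  have 0: "fps_nth (linear_gf {}) 0 = 0" "fps_nth (linear_gf {}) 1 = 0"
    by (rule closed_gf_nth_eq_0, simp)+
  have "fps_nth (linear_gf {}) 2 = [:1, 1:]"
    using closed_gf_nth_Suc[of 1] 0 by (simp add: numeral_2_eq_2)
  then show ?thesis
    using coeff_closed_gf[of 0 r] by (simp add: coeff_pCons numeral_2_eq_2 split: nat.splits)
qed

lemma id_moment_Suc:
  "id_moment (Suc k) r = (\<Sum>i\<le>k. \<Sum>s\<le>r. id_moment i s * id_moment (k - i) (r - s)) +
     2 * (3 * real k + 2 - real r) * id_moment k r"
proof -
  let ?t = "fps_nth (linear_gf {})"
  \<comment> \<open>Only \<open>i = 3 * j + 2\<close> contributes, and \<open>j > k\<close> would
    give \<open>i > 3 * k + 4\<close>.\<close>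
  have "(\<Sum>i\<le>3 * k + 4. ?t i * ?t (3 * k + 4 - i)) = (\<Sum>i\<in>(\<lambda>j. 3 * j + 2) ` {..k}. ?t i * ?t (3 * k + 4 - i))"
  proof (rule sum.mono_neutral_right)
    show "\<forall>i\<in>{..3 * k + 4} - (\<lambda>j. 3 * j + 2) ` {..k}. ?t i * ?t (3 * k + 4 - i) = 0"
    proof
      fix i assume i: "i \<in> {..3 * k + 4} - (\<lambda>j. 3 * j + 2) ` {..k}"
      show "?t i * ?t (3 * k + 4 - i) = 0"
      proof (cases "i mod 3 = 2")
        case True
        then have *: "i = 3 * (i div 3) + 2" by presburger
        then have "i \<in> (\<lambda>j. 3 * j + 2) ` {..k} \<or> i div 3 > k"
          by (metis atMost_iff imageI not_le)
        with i * have False by auto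
        then show ?thesis ..
      next
        case False
        then show ?thesis by (simp add: closed_gf_nth_eq_0)
      qed
    qed
  qed auto
  also have "\<dots> = (\<Sum>j\<le>k. ?t (3 * j + 2) * ?t (3 * (k - j) + 2))"
    by (subst sum.reindex) (auto simp: inj_on_def diff_mult_distrib2 intro!: sum.cong arg_cong[where f = ?t])
  finally have conv: "(\<Sum>i\<le>3 * k + 4. ?t i * ?t (3 * k + 4 - i)) = (\<Sum>j\<le>k. ?t (3 * j + 2) * ?t (3 * (k - j) + 2))" .
  have "?t (3 * Suc k + 2) = (\<Sum>j\<le>k. ?t (3 * j + 2) * ?t (3 * (k - j) + 2)) +
     2 * fps_nth (grade_deriv (linear_gf {})) (3 * k + 2)"
    using closed_gf_nth_Suc[of "3 * k + 4"] conv by (simp add: eval_nat_numeral)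
  then have "id_moment (Suc k) r = coeff (\<Sum>j\<le>k. ?t (3 * j + 2) * ?t (3 * (k - j) + 2)) r +
     2 * coeff (fps_nth (grade_deriv (linear_gf {})) (3 * k + 2)) r"
    unfolding coeff_closed_gf[symmetric] mult_2 by (simp only: coeff_add)
  also have "coeff (fps_nth (grade_deriv (linear_gf {})) (3 * k + 2)) r = (3 * real k + 2 - real r) * id_moment k r"
  proof -
    have "coeff (of_nat m * p - [:0, 1:] * pderiv p) r = (real m - real r) * coeff p r" for m :: nat and p :: "real poly"
      by (cases r) (simp_all add: of_nat_poly coeff_pCons coeff_pderiv algebra_simps)
    from this[of "3 * k + 2" "?t (3 * k + 2)"] show ?thesis
      unfolding grade_deriv_def coeff_closed_gf[symmetric] fps_nth_Abs_fps by simp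
  qed
  also have "coeff (\<Sum>j\<le>k. ?t (3 * j + 2) * ?t (3 * (k - j) + 2)) r =
     (\<Sum>i\<le>k. \<Sum>s\<le>r. id_moment i s * id_moment (k - i) (r - s))"
    by (simp only: coeff_sum coeff_mult coeff_closed_gf)
  finally show ?thesis by simp
qed

text \<open>At most \<open>k + 1\<close> identities fit into size \<open>3 * k + 2\<close>. This
  later excludes the indices at which \<open>6 k + 6 - 2 r\<close> could be negative.\<close>

lemma id_moment_eq_0: "r > k + 1 \<Longrightarrow> id_moment k r = 0"
proof (induction k arbitrary: r rule: less_induct)
  case (less k)
  show ?case
  proof (cases k)
    case 0
    then show ?thesis using less.prems by (simp add: id_moment_0)
  next
    case (Suc m)
    have "(\<Sum>i\<le>m. \<Sum>s\<le>r. id_moment i s * id_moment (m - i) (r - s)) = 0"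
    proof (intro sum.neutral ballI)
      fix i s assume "i \<in> {..m}" "s \<in> {..r}"
      then have that: "i \<le> m" "s \<le> r" by auto
      show "id_moment i s * id_moment (m - i) (r - s) = 0"
    proof (cases "s > i + 1")
      case False
      then have "r - s > (m - i) + 1" using less.prems that Suc by auto
      then show ?thesis using less.IH[of "m - i" "r - s"] Suc by simp
    qed (use less.IH[of i s] that Suc in simp)
    qed
    moreover have "id_moment m r = 0" using less Suc by simp
    ultimately show ?thesis
      unfolding Suc id_moment_Suc by simp
  qed
qed

section \<open>Asymptotics of the factorial moments\<close>

abbreviation term_count :: "nat \<Rightarrow> real" where
  "term_count k \<equiv> id_moment k 0"

definition inner_convolution :: "nat \<Rightarrow> real" where
  "inner_convolution k = (\<Sum>i\<in>{1..<k}. term_count i * term_count (k - i))"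

lemma inner_convolution_nonneg: "inner_convolution k \<ge> 0"
  by (simp add: inner_convolution_def sum_nonneg id_moment_nonneg)

lemma sum_split_ends:
  fixes f :: "nat \<Rightarrow> 'a :: comm_monoid_add"
  assumes "k \<ge> 1"
  shows "(\<Sum>i\<le>k. f i) = f 0 + f k + (\<Sum>i\<in>{1..<k}. f i)"
proof -
  have "{..k} = insert 0 (insert k {1..<k})" using assms by auto
  then show ?thesis using assms by (simp add: add.assoc)
qed

text \<open>For \<open>k \<ge> 1\<close> the two end summands of the convolution are distinct; with
  \<open>term_count 0 = 1\<close> they raise the coefficient from \<open>6 k + 4\<close> to
  \<open>6 k + 6\<close>.\<close>

lemma term_count_Suc:
  assumes "k \<ge> 1"
  shows "term_count (Suc k) = (6 * real k + 6) * term_count k + inner_convolution k"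
proof -
  have "(\<Sum>i\<le>k. term_count i * term_count (k - i)) = 2 * term_count k + inner_convolution k"
    using sum_split_ends[OF assms, of "\<lambda>i. term_count i * term_count (k - i)"]
    by (simp add: inner_convolution_def id_moment_0)
  then show ?thesis
    by (simp add: id_moment_Suc algebra_simps)
qed

lemma term_count_1: "term_count 1 = 5"
  using id_moment_Suc[of 0 0] by (simp add: id_moment_0)

lemma term_count_growth: "term_count (Suc k) \<ge> (6 * real k + 4) * term_count k"
proof -
  have "(\<Sum>i\<le>k. term_count i * term_count (k - i)) \<ge> 0"
    by (intro sum_nonneg mult_nonneg_nonneg id_moment_nonneg)
  then show ?thesis by (simp add: id_moment_Suc algebra_simps)
qed

lemma term_count_pos: "term_count k > 0"
proof (induction k)
  case (Suc k)
  have "0 < (6 * real k + 4) * term_count k"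
    using Suc by (intro mult_pos_pos) auto
  also have "\<dots> \<le> term_count (Suc k)" by (rule term_count_growth)
  finally show ?case .
qed (simp add: id_moment_0)

text \<open>The ratios \<open>term_count (l + 1) / term_count l\<close> lie in \<open>[6 l + 4, 6 l + 10]\<close> and are therefore
  increasing, so that the sequence is log-convex. The upper bound is a hypothesis, for
  \<open>l < k\<close> only, because it is itself proved by induction from its consequences.\<close>

lemma term_count_mult_le:
  assumes ratio: "\<And>l. l < k \<Longrightarrow> term_count (Suc l) \<le> (6 * real l + 10) * term_count l"
  assumes "m \<le> i" "i \<le> k" "i \<le> j"
  shows "term_count i * term_count j \<le> term_count m * term_count (j + (i - m))"
  using assms(2-)
proof (induction i arbitrary: j rule: dec_induct)
  case (step i)
  have "term_count (Suc i) * term_count j \<le> (6 * real i + 10) * term_count i * term_count j"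
    using ratio[of i] step.prems by (intro mult_right_mono id_moment_nonneg) auto
  \<comment> \<open>Here \<open>j \<ge> i + 1\<close>, so
    \<open>6 i + 10 \<le> 6 j + 4\<close>.\<close>
  also have "\<dots> \<le> term_count i * ((6 * real j + 4) * term_count j)"
    using step.prems term_count_pos[of i] term_count_pos[of j] by (simp add: mult.assoc mult_left_mono)
  also have "\<dots> \<le> term_count i * term_count (Suc j)"
    by (intro mult_left_mono term_count_growth id_moment_nonneg)
  also have "\<dots> \<le> term_count m * term_count (Suc j + (i - m))"
    using step.prems by (intro step.IH) auto
  finally show ?case using step.hyps by (simp add: Suc_diff_le)
qed simp

lemma term_count_mult_le':
  assumes ratio: "\<And>l. l < k \<Longrightarrow> term_count (Suc l) \<le> (6 * real l + 10) * term_count l"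
  assumes "m \<le> i" "i \<le> k - m" "m \<le> k"
  shows "term_count i * term_count (k - i) \<le> term_count m * term_count (k - m)"
proof (cases "i \<le> k - i")
  case True
  then show ?thesis
    using term_count_mult_le[of k m i "k - i"] assms by auto
next
  case False
  then show ?thesis
    using term_count_mult_le[of k m "k - i" i] assms by (auto simp: mult.commute)
qed

text \<open>By log-convexity each of the \<open>k - 1\<close> summands is at most
  \<open>5 * term_count (k - 1)\<close>, and \<open>5 (k - 1)\<close> is below the growth factor
  \<open>6 (k - 1) + 4\<close>.\<close>

lemma inner_convolution_le_aux:
  assumes "\<And>l. l < k \<Longrightarrow> term_count (Suc l) \<le> (6 * real l + 10) * term_count l"
  assumes "k \<ge> 1"
  shows "inner_convolution k \<le> term_count k"
proof -
  have "inner_convolution k \<le> (\<Sum>i\<in>{1..<k}. term_count 1 * term_count (k - 1))"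
    unfolding inner_convolution_def using assms by (intro sum_mono term_count_mult_le') auto
  also have "\<dots> = 5 * (real k - 1) * term_count (k - 1)"
    using assms(2) by (simp add: term_count_1[simplified] of_nat_diff)
  also have "\<dots> \<le> (6 * real (k - 1) + 4) * term_count (k - 1)"
    using assms(2) by (intro mult_right_mono id_moment_nonneg) auto
  also have "\<dots> \<le> term_count (Suc (k - 1))" by (rule term_count_growth)
  finally show ?thesis using assms(2) by simp
qed

text \<open>The convolution bound at \<open>k\<close> needs the ratio bound only below
  \<open>k\<close>, so strong induction closes the circle.\<close>

lemma term_count_ratio: "term_count (Suc k) \<le> (6 * real k + 7) * term_count k"
proof (induction k rule: less_induct)
  case (less k)
  show ?case
  proof (cases "k = 0")
    case True
    then show ?thesis using term_count_1 by (simp add: id_moment_0)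
  next
    case False
    have "term_count (Suc l) \<le> (6 * real l + 10) * term_count l" if "l < k" for l
      using less.IH[OF that] term_count_pos[of l] by (simp add: algebra_simps)
    then have "inner_convolution k \<le> term_count k"
      using False by (intro inner_convolution_le_aux) auto
    then show ?thesis using term_count_Suc[of k] False by (simp add: algebra_simps)
  qed
qed

lemma term_count_ratio': "term_count (Suc k) \<le> (6 * real k + 10) * term_count k"
  using term_count_ratio[of k] term_count_pos[of k] by (simp add: algebra_simps)

lemma inner_convolution_le: "inner_convolution k \<le> term_count k"
proof (cases "k = 0")
  case False
  then show ?thesis by (intro inner_convolution_le_aux term_count_ratio') auto
qed (simp add: inner_convolution_def id_moment_nonneg)

text \<open>The two outermost summands are of relative order \<open>1 / k\<close>. Each of the at
  most \<open>k\<close> others is bounded by \<open>term_count 2 * term_count (k - 2)\<close>, of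
  relative order \<open>1 / k^2\<close>.\<close>

lemma inner_convolution_ratio_le:
  assumes "k \<ge> 4"
  shows "inner_convolution k / term_count k \<le> 2 * term_count 1 / real k + term_count 2 / (real k - 1)"
proof -
  let ?a = term_count
  have "{1..<k} = insert 1 (insert (k - 1) {2..k-2})" using assms by auto
  then have "inner_convolution k = ?a 1 * ?a (k - 1) + (?a (k - 1) * ?a 1 + (\<Sum>i\<in>{2..k-2}. ?a i * ?a (k - i)))"
  proof -
    have "1 \<notin> insert (k - 1) {2..k-2}" "k - 1 \<notin> {2..k-2}" using assms by auto
    then show ?thesis
      unfolding inner_convolution_def \<open>{1..<k} = _\<close> using assms by simp
  qed
  also have "(\<Sum>i\<in>{2..k-2}. ?a i * ?a (k - i)) \<le> (\<Sum>i\<in>{2..k-2}. ?a 2 * ?a (k - 2))"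
    using assms by (intro sum_mono term_count_mult_le' term_count_ratio') auto
  also have "\<dots> \<le> real k * (?a 2 * ?a (k - 2))"
    by (auto intro!: mult_right_mono mult_nonneg_nonneg id_moment_nonneg)
  finally have 1: "inner_convolution k \<le> 2 * ?a 1 * ?a (k - 1) + real k * ?a 2 * ?a (k - 2)"
    by simp
  obtain j where k: "k = Suc (Suc j)" using assms by (intro that[of "k - 2"]) simp
  have a1: "?a (Suc j) \<le> ?a k / real k"
  proof -
    have "real k * ?a (Suc j) \<le> (6 * real (Suc j) + 4) * ?a (Suc j)"
      using k by (intro mult_right_mono id_moment_nonneg) auto
    also have "\<dots> \<le> ?a k" unfolding k by (rule term_count_growth)
    finally show ?thesis using assms by (simp add: field_simps)
  qed
  have a2: "?a j \<le> ?a k / real k / (real k - 1)"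
  proof -
    have "(real k - 1) * ?a j \<le> (6 * real j + 4) * ?a j"
      using k by (intro mult_right_mono id_moment_nonneg) auto
    also have "\<dots> \<le> ?a (Suc j)" by (rule term_count_growth)
    also note a1
    finally show ?thesis using assms by (simp add: field_simps)
  qed
  have "inner_convolution k \<le> 2 * ?a 1 * (?a k / real k) + real k * ?a 2 * (?a k / real k / (real k - 1))"
    using 1 a1 a2 k
    by (intro order.trans[OF 1] add_mono mult_left_mono mult_nonneg_nonneg id_moment_nonneg) auto
  also have "\<dots> = ?a k * (2 * ?a 1 / real k + ?a 2 / (real k - 1))"
    using assms by (simp add: field_simps)
  finally show ?thesis using term_count_pos[of k] by (simp add: divide_le_eq mult.commute)
qed

lemma inner_convolution_ratio_tendsto_0: "(\<lambda>k. inner_convolution k / term_count k) \<longlonglongrightarrow> 0"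
proof (rule tendsto_sandwich)
  show "\<forall>\<^sub>F k in sequentially. 0 \<le> inner_convolution k / term_count k"
    using inner_convolution_nonneg id_moment_nonneg by simp
  show "\<forall>\<^sub>F k in sequentially. inner_convolution k / term_count k \<le>
      2 * term_count 1 / real k + term_count 2 / (real k - 1)"
    using eventually_ge_at_top[of 4] by eventually_elim (rule inner_convolution_ratio_le)
  show "(\<lambda>k. 2 * term_count 1 / real k + term_count 2 / (real k - 1)) \<longlonglongrightarrow> 0"
    by real_asymp
qed auto

section \<open>Boundedness and limits of the normalised moments\<close>

text \<open>At size 2 the moments of order 0 and 1 are \<open>1\<close> and the others vanish, so
  each end of the convolution contributes
  \<open>id_moment k r + id_moment k (r - 1)\<close>.\<close>

lemma id_moment_Suc_split:
  assumes "k \<ge> 1" "r \<ge> 1"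
  shows "id_moment (Suc k) r = (6 * real k + 6 - 2 * real r) * id_moment k r + 2 * id_moment k (r - 1) +
    (\<Sum>i\<in>{1..<k}. \<Sum>s\<le>r. id_moment i s * id_moment (k - i) (r - s))"
proof -
  obtain q where r: "r = Suc q" using assms by (cases r) auto
  have 0: "(\<Sum>s\<le>r. id_moment 0 s * id_moment k (r - s)) = id_moment k r + id_moment k (r - 1)"
  proof -
    have "(\<Sum>s\<le>r. id_moment 0 s * id_moment k (r - s)) = (\<Sum>s\<in>{0, 1}. id_moment 0 s * id_moment k (r - s))"
      using assms by (intro sum.mono_neutral_right) (auto simp: id_moment_0)
    then show ?thesis by (simp add: id_moment_0)
  qed
  have 1: "(\<Sum>s\<le>r. id_moment k s * id_moment 0 (r - s)) = id_moment k r + id_moment k (r - 1)"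
  proof -
    have "(\<Sum>s\<le>r. id_moment k s * id_moment 0 (r - s)) = (\<Sum>s\<in>{r, q}. id_moment k s * id_moment 0 (r - s))"
      by (intro sum.mono_neutral_right) (auto simp: id_moment_0 r)
    then show ?thesis by (simp add: id_moment_0 r)
  qed
  show ?thesis
    unfolding id_moment_Suc sum_split_ends[OF assms(1)] using 0 1 by (simp add: algebra_simps)
qed

text \<open>In the recurrence for moment \<open>r\<close> the extreme summands of the convolution involve moment
  \<open>r\<close> itself; they are absorbed by the decrease \<open>- 2 r\<close> of the leading coefficient.\<close>

lemma id_moment_bounded: "\<exists>K\<ge>1. \<forall>s\<le>r. \<forall>k. id_moment k s \<le> K * term_count k"
proof (induction r)
  case (Suc q)
  then obtain K0 where K0: "K0 \<ge> 1" "\<And>s k. s \<le> q \<Longrightarrow> id_moment k s \<le> K0 * term_count k"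
    by blast
  define r where "r = Suc q"
  \<comment> \<open>The summands pay for the moment of order \<open>r - 1\<close>, for the mixed
    products of lower moments, and for the base case \<open>k = 1\<close>.\<close>
  define K where "K = 2 * K0 + real r * K0\<^sup>2 + id_moment 1 r"
  have K_ge: "2 * K0 + real r * K0\<^sup>2 \<le> K" "id_moment 1 r \<le> K" "K0 \<le> K" "K \<ge> 1"
    using K0(1) id_moment_nonneg[of 1 r] by (auto simp: K_def add_increasing2)
  have "id_moment k r \<le> K * term_count k" for k
  proof (induction k rule: less_induct)
    case (less k)
    consider "k = 0" | "k = 1" | j where "k = Suc j" "j \<ge> 1"
      by (metis One_nat_def Suc_leI neq0_conv not0_implies_Suc)
    then show ?case
    proof cases
      case 1
      then show ?thesis using K_ge by (auto simp: id_moment_0)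
    next
      case 2
      have "id_moment 1 r \<le> K * 5" using K_ge by linarith
      then show ?thesis using 2 term_count_1 by simp
    next
      case (3 j)
      show ?thesis
      proof (cases "r > k + 1")
        case True
        then show ?thesis using id_moment_eq_0[OF True] K_ge id_moment_nonneg[of k 0] by simp
      next
        case False
        \<comment> \<open>The summands \<open>s = 0\<close> and \<open>s = r\<close> use the
          induction on \<open>k\<close> (constant \<open>K\<close>), the mixed ones the induction on
          \<open>r\<close> (constant \<open>K0\<close>).\<close>
        have inner: "(\<Sum>s\<le>r. id_moment i s * id_moment (j - i) (r - s)) \<le>
          (2 * K + real r * K0\<^sup>2) * (term_count i * term_count (j - i))" if "i \<in> {1..<j}" for i
        proof -
          have "(\<Sum>s\<in>{1..<r}. id_moment i s * id_moment (j - i) (r - s)) \<le>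
             (\<Sum>s\<in>{1..<r}. (K0 * term_count i) * (K0 * term_count (j - i)))"
            using K0 by (intro sum_mono mult_mono id_moment_nonneg mult_nonneg_nonneg) (auto simp: r_def)
          also have "\<dots> = real q * (K0\<^sup>2 * (term_count i * term_count (j - i)))"
            by (simp add: r_def power2_eq_square)
          also have "\<dots> \<le> real r * (K0\<^sup>2 * (term_count i * term_count (j - i)))"
            by (intro mult_right_mono mult_nonneg_nonneg id_moment_nonneg) (auto simp: r_def)
          finally have mid: "(\<Sum>s\<in>{1..<r}. id_moment i s * id_moment (j - i) (r - s)) \<le>
             real r * (K0\<^sup>2 * (term_count i * term_count (j - i)))" .
          have e1: "term_count i * id_moment (j - i) r \<le> term_count i * (K * term_count (j - i))"
            using less.IH[of "j - i"] 3 that by (intro mult_left_mono id_moment_nonneg) auto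
          have e2: "id_moment i r * term_count (j - i) \<le> (K * term_count i) * term_count (j - i)"
            using less.IH[of i] 3 that by (intro mult_right_mono id_moment_nonneg) auto
          show ?thesis
            using mid e1 e2 sum_split_ends[of r "\<lambda>s. id_moment i s * id_moment (j - i) (r - s)"]
            by (simp add: r_def algebra_simps)
        qed
        have "(\<Sum>i\<in>{1..<j}. \<Sum>s\<le>r. id_moment i s * id_moment (j - i) (r - s)) \<le>
            (\<Sum>i\<in>{1..<j}. (2 * K + real r * K0\<^sup>2) * (term_count i * term_count (j - i)))"
          by (rule sum_mono) (rule inner)
        also have "\<dots> = (2 * K + real r * K0\<^sup>2) * inner_convolution j"
          by (simp add: inner_convolution_def sum_distrib_left)
        finally have mid: "(\<Sum>i\<in>{1..<j}. \<Sum>s\<le>r. id_moment i s * id_moment (j - i) (r - s)) \<le>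
            (2 * K + real r * K0\<^sup>2) * inner_convolution j" .
        \<comment> \<open>This makes the leading coefficient \<open>6 j + 6 - 2 r\<close>
          nonnegative.\<close>
        have "r \<le> j + 2" using False 3 by simp
        then have "(6 * real j + 6 - 2 * real r) * id_moment j r \<le> (6 * real j + 6 - 2 * real r) * (K * term_count j)"
          using less.IH[of j] 3 by (intro mult_left_mono) auto
        moreover have "id_moment j (r - 1) \<le> K0 * term_count j"
          by (rule K0) (simp add: r_def)
        \<comment> \<open>One \<open>K * inner_convolution j\<close> belongs to the target bound.
          The rest of the convolution and \<open>2 * K0 * term_count j\<close> total at most
          \<open>2 * K * term_count j\<close>, which the damping \<open>2 r\<close> absorbs as
          \<open>r \<ge> 1\<close>.\<close>
        moreover have "(K + real r * K0\<^sup>2) * inner_convolution j \<le> (K + real r * K0\<^sup>2) * term_count j"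
          using K_ge by (intro mult_left_mono inner_convolution_le) auto
        moreover have "(2 * K0 + real r * K0\<^sup>2) * term_count j \<le> K * term_count j"
          using K_ge by (intro mult_right_mono id_moment_nonneg)
        moreover have "2 * (K * term_count j) \<le> 2 * real r * (K * term_count j)"
          using K_ge id_moment_nonneg[of j 0] by (intro mult_right_mono) (auto simp: r_def)
        ultimately have "id_moment (Suc j) r \<le> K * ((6 * real j + 6) * term_count j + inner_convolution j)"
          using id_moment_Suc_split[of j r] 3 mid by (simp add: r_def algebra_simps)
        then show ?thesis using 3 term_count_Suc[of j] by simp
      qed
    qed
  qed
  moreover have "id_moment k s \<le> K * term_count k" if "s \<le> q" for s k
    using K0(2)[OF that, of k] K_ge mult_right_mono[OF K_ge(3) id_moment_nonneg[of k 0]] by linarith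
  ultimately show ?case using K_ge(4) by (metis le_Suc_eq r_def)
qed (auto intro!: exI[of _ 1])

text \<open>The perturbation \<open>z\<close> is of lower order than the damping \<open>c\<close>, and the total damping
  \<open>\<Sum>k. c / \<rho> k\<close> diverges like the harmonic series.\<close>

lemma damped_recurrence_tendsto_0:
  fixes w \<rho> z :: "nat \<Rightarrow> real"
  assumes rec: "\<And>k. k \<ge> start \<Longrightarrow> w (Suc k) * \<rho> k = (\<rho> k - c) * w k + z k"
    and c: "c > 0" and lower: "\<And>k. k \<ge> start \<Longrightarrow> c \<le> \<rho> k" and upper: "\<And>k. \<rho> k \<le> A * real (Suc k)"
    and z: "z \<longlonglongrightarrow> 0"
  shows "w \<longlonglongrightarrow> 0"
proof (rule LIMSEQ_I)
  fix e :: real assume "e > 0"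
  define d where "d = e / 2"
  have d: "d > 0" using \<open>e > 0\<close> by (simp add: d_def)
  have "d * c > 0" using d c by simp
  from LIMSEQ_D[OF z this] obtain n1 where n1: "\<And>k. k \<ge> n1 \<Longrightarrow> \<bar>z k\<bar> < d * c" by auto
  define N where "N = max start n1"
  have "0 < A * real (Suc start)" using upper[of start] lower[of start] c by simp
  then have A: "A > 0" by (simp add: zero_less_mult_iff)
  define b where "b = c / A"
  have b: "b > 0" using c A by (simp add: b_def)
  \<comment> \<open>The excess of \<open>w\<close> in absolute value over \<open>d\<close>
    contracts: \<open>z\<close> is smaller than \<open>d * c\<close>, so it cannot lift values above
    this threshold.\<close>
  define u where "u k = max 0 (\<bar>w k\<bar> - d)" for k
  have damp: "u (Suc k) \<le> exp (- b / real (Suc k)) * u k" if k: "k \<ge> N" for k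
  proof -
    have \<rho>: "\<rho> k > 0" "c \<le> \<rho> k" using lower[of k] c k by (auto simp: N_def)
    have "\<bar>w (Suc k)\<bar> * \<rho> k = \<bar>(\<rho> k - c) * w k + z k\<bar>"
      using rec[of k] k \<rho> by (metis N_def abs_mult abs_of_pos max.boundedE)
    also have "\<dots> \<le> (\<rho> k - c) * \<bar>w k\<bar> + d * c"
      using n1[of k] k \<rho> abs_triangle_ineq[of "(\<rho> k - c) * w k" "z k"] by (simp add: N_def abs_mult)
    finally have "(\<bar>w (Suc k)\<bar> - d) * \<rho> k \<le> (\<rho> k - c) * (\<bar>w k\<bar> - d)"
      by (simp add: algebra_simps)
    also have "\<dots> \<le> (\<rho> k - c) * u k"
      using \<rho> by (intro mult_left_mono) (auto simp: u_def)
    finally have "\<bar>w (Suc k)\<bar> - d \<le> (1 - c / \<rho> k) * u k"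
      using \<rho> by (simp add: field_simps)
    moreover have "0 \<le> (1 - c / \<rho> k) * u k" using \<rho> by (simp add: u_def)
    ultimately have "u (Suc k) \<le> (1 - c / \<rho> k) * u k" by (simp add: u_def)
    also have "\<dots> \<le> exp (- b / real (Suc k)) * u k"
    proof (rule mult_right_mono)
      have "b / real (Suc k) = c / (A * real (Suc k))" by (simp add: b_def)
      also have "\<dots> \<le> c / \<rho> k"
        using upper[of k] \<rho> c by (intro divide_left_mono) auto
      finally have "1 - c / \<rho> k \<le> 1 + (- b / real (Suc k))" by simp
      also have "\<dots> \<le> exp (- b / real (Suc k))" by (rule exp_ge_add_one_self)
      finally show "1 - c / \<rho> k \<le> exp (- b / real (Suc k))" .
    qed (simp add: u_def)
    finally show ?thesis .
  qed
  \<comment> \<open>The contraction factors multiply to the exponential of a difference of harmonic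
    numbers.\<close>
  have bound: "u k \<le> exp (b * (harm N - harm k)) * u N" if "k \<ge> N" for k
    using that
  proof (induction k rule: dec_induct)
    case (step k)
    have "u (Suc k) \<le> exp (- b / real (Suc k)) * u k" by (rule damp) fact
    also have "\<dots> \<le> exp (- b / real (Suc k)) * (exp (b * (harm N - harm k)) * u N)"
      by (intro mult_left_mono step.IH) auto
    also have "\<dots> = exp (- b / real (Suc k) + b * (harm N - harm k)) * u N"
      by (simp only: exp_add mult.assoc)
    also have "- b / real (Suc k) + b * (harm N - harm k) = b * (harm N - harm (Suc k))"
      by (simp add: harm_Suc algebra_simps divide_inverse)
    finally show ?case .
  qed simp
  have "filterlim (\<lambda>k. b * (harm k - harm N)) at_top sequentially"
  proof -
    have "filterlim (\<lambda>k. - harm N + harm k :: real) at_top sequentially"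
      by (rule filterlim_tendsto_add_at_top[OF tendsto_const harm_at_top])
    then have "filterlim (\<lambda>k. b * (- harm N + harm k)) at_top sequentially"
      by (rule filterlim_tendsto_pos_mult_at_top[OF tendsto_const b])
    then show ?thesis by simp
  qed
  then have "filterlim (\<lambda>k. - (b * (harm k - harm N))) at_bot sequentially"
    by (simp add: filterlim_uminus_at_top)
  then have "(\<lambda>k. exp (- (b * (harm k - harm N))) * u N) \<longlonglongrightarrow> 0 * u N"
    by (intro tendsto_mult tendsto_const filterlim_compose[OF exp_at_bot])
  then have "(\<lambda>k. exp (b * (harm N - harm k)) * u N) \<longlonglongrightarrow> 0"
    by (simp add: algebra_simps)
  from LIMSEQ_D[OF this d] obtain n2 where n2: "\<And>k. k \<ge> n2 \<Longrightarrow> exp (b * (harm N - harm k)) * u N < d"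
    by (auto simp: u_def abs_mult)
  have "norm (w k - 0) < e" if "k \<ge> max N n2" for k
  proof -
    have "u k < d" using bound[of k] n2[of k] that by auto
    then have "\<bar>w k\<bar> < 2 * d" by (simp add: u_def)
    then show ?thesis by (simp add: d_def)
  qed
  then show "\<exists>no. \<forall>k\<ge>no. norm (w k - 0) < e" by blast
qed

lemma id_moment_ratio_tendsto:
  "(\<lambda>k. id_moment k r / term_count k) \<longlonglongrightarrow> 1 / fact r"
proof (induction r)
  case 0
  then show ?case using term_count_pos by (simp add: less_imp_neq[symmetric])
next
  case (Suc q)
  define r where "r = Suc q"
  define f where "f k s = id_moment k s / term_count k" for k s
  define \<eta> where "\<eta> k = inner_convolution k / term_count k" for k
  define m where "m k = (\<Sum>i\<in>{1..<k}. \<Sum>s\<le>r. id_moment i s * id_moment (k - i) (r - s)) / term_count k" for k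
  obtain K where K: "K \<ge> 1" "\<And>s k. s \<le> r \<Longrightarrow> id_moment k s \<le> K * term_count k"
    using id_moment_bounded[of r] by blast
  have \<eta>: "\<eta> \<longlonglongrightarrow> 0" unfolding \<eta>_def by (rule inner_convolution_ratio_tendsto_0)
  have f_bounds: "0 \<le> f k r" "f k r \<le> K" for k
    using K(2)[of r k] term_count_pos[of k] id_moment_nonneg[of k r]
    by (auto simp: f_def divide_le_eq)
  have m: "m \<longlonglongrightarrow> 0"
  proof (rule tendsto_sandwich)
    show "\<forall>\<^sub>F k in sequentially. 0 \<le> m k"
      by (intro always_eventually allI, unfold m_def)
         (intro divide_nonneg_nonneg sum_nonneg mult_nonneg_nonneg id_moment_nonneg)
    show "\<forall>\<^sub>F k in sequentially. m k \<le> real (Suc r) * K\<^sup>2 * \<eta> k"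
    proof (intro always_eventually allI)
      fix k
      have "(\<Sum>i\<in>{1..<k}. \<Sum>s\<le>r. id_moment i s * id_moment (k - i) (r - s)) \<le>
         (\<Sum>i\<in>{1..<k}. \<Sum>s\<le>r. (K * term_count i) * (K * term_count (k - i)))"
        using K by (intro sum_mono mult_mono mult_nonneg_nonneg id_moment_nonneg) auto
      also have "\<dots> = real (Suc r) * K\<^sup>2 * inner_convolution k"
        by (simp add: inner_convolution_def sum_distrib_left power2_eq_square mult_ac)
      finally show "m k \<le> real (Suc r) * K\<^sup>2 * \<eta> k"
        using term_count_pos[of k] by (simp add: m_def \<eta>_def divide_right_mono)
    qed
    show "(\<lambda>k. real (Suc r) * K\<^sup>2 * \<eta> k) \<longlonglongrightarrow> 0"
      using tendsto_mult_left[OF \<eta>, of "real (Suc r) * K\<^sup>2"] by simp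
  qed auto
  have \<eta>f: "(\<lambda>k. \<eta> k * f k r) \<longlonglongrightarrow> 0"
  proof (rule tendsto_0_le[OF \<eta>, of _ K])
    show "\<forall>\<^sub>F k in sequentially. norm (\<eta> k * f k r) \<le> norm (\<eta> k) * K"
      using f_bounds by (intro always_eventually allI) (auto simp: abs_mult intro!: mult_left_mono)
  qed
  \<comment> \<open>Writing \<open>6 k + 6\<close> as \<open>\<rho> k - \<eta> k\<close> produces
    the first summand; the last centres the recurrence at \<open>1 / fact r\<close>. The limit is
    zero because \<open>r / r! = 1 / q!\<close>.\<close>
  define z where "z k = - (\<eta> k * f k r) + 2 * f k q + m k - 2 * real r * (1 / fact r)" for k
  have "z \<longlonglongrightarrow> - 0 + 2 * (1 / fact q) + 0 - 2 * real r * (1 / fact r)"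
    unfolding z_def using Suc.IH \<eta>f m by (intro tendsto_intros) (auto simp: f_def)
  also have "- 0 + 2 * (1 / fact q) + 0 - 2 * real r * (1 / fact r) = (0 :: real)"
  proof -
    have "real r * (1 / fact r) = 1 / fact q" by (simp add: r_def del: of_nat_Suc)
    then show ?thesis by (simp add: mult.assoc)
  qed
  finally have z: "z \<longlonglongrightarrow> 0" .
  define \<rho> where "\<rho> k = term_count (Suc k) / term_count k" for k
  \<comment> \<open>The damping is \<open>c = 2 r\<close>; \<open>A = 7\<close> comes from
    \<open>6 k + 7 \<le> 7 (k + 1)\<close>; from \<open>Suc r\<close> on,
    \<open>2 r \<le> \<rho> k\<close> and the split recurrence applies.\<close>
  have "(\<lambda>k. f k r - 1 / fact r) \<longlonglongrightarrow> 0"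
  proof (rule damped_recurrence_tendsto_0[where start = "Suc r" and c = "2 * real r" and \<rho> = \<rho> and z = z and A = 7])
    fix k
    show "\<rho> k \<le> 7 * real (Suc k)"
    proof -
      have "(6 * real k + 7) * term_count k \<le> 7 * real (Suc k) * term_count k"
        by (intro mult_right_mono id_moment_nonneg) simp
      with term_count_ratio[of k] have "term_count (Suc k) \<le> 7 * real (Suc k) * term_count k"
        by linarith
      then show ?thesis
        using term_count_pos[of k] by (simp only: \<rho>_def pos_divide_le_eq)
    qed
    assume k: "k \<ge> Suc r"
    have \<rho>: "\<rho> k = 6 * real k + 6 + \<eta> k"
      using term_count_Suc[of k] k term_count_pos[of k] by (simp add: \<rho>_def \<eta>_def field_simps)
    have "\<eta> k \<ge> 0" using inner_convolution_nonneg id_moment_nonneg by (simp add: \<eta>_def)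
    then show "2 * real r \<le> \<rho> k" using \<rho> k by simp
    have "f (Suc k) r * \<rho> k = id_moment (Suc k) r / term_count k"
      using term_count_pos[of "Suc k"] by (simp add: f_def \<rho>_def)
    also have "\<dots> = (6 * real k + 6 - 2 * real r) * f k r + 2 * f k q + m k"
      using id_moment_Suc_split[of k r] k by (simp add: r_def f_def m_def add_divide_distrib)
    finally show "(f (Suc k) r - 1 / fact r) * \<rho> k = (\<rho> k - 2 * real r) * (f k r - 1 / fact r) + z k"
      by (simp add: z_def \<rho> algebra_simps)
  qed (use z in \<open>auto simp: r_def\<close>)
  then show ?case
    using tendsto_add[of "\<lambda>k. f k r - 1 / fact r" 0 sequentially "\<lambda>_. 1 / fact r"]
    by (simp add: f_def r_def)
qed

section \<open>Convergence of characteristic functions\<close>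

text \<open>For \<open>R \<ge> 1\<close>, Pascal's rule makes the remainder at \<open>Suc x\<close>
  equal to \<open>1 + w\<close> times that at \<open>x\<close> plus
  \<open>(x choose (R - 1)) * w ^ R\<close>. The factor has norm at most 1, so the bounds add up by
  Pascal's rule again.\<close>

lemma binomial_remainder:
  fixes w :: complex
  assumes "norm (1 + w) \<le> 1"
  shows "norm ((1 + w) ^ x - (\<Sum>r<R. of_nat (x choose r) * w ^ r)) \<le> real (x choose R) * norm w ^ R"
proof (cases R)
  case 0
  then show ?thesis using assms by (simp add: norm_power power_le_one)
next
  case (Suc q)
  show ?thesis
  proof (induction x)
    case 0
    have "(\<Sum>r<R. of_nat (0 choose r) * w ^ r) = (\<Sum>r\<in>{0}. of_nat (0 choose r) * w ^ r)"
      using Suc by (intro sum.mono_neutral_right) (auto simp: binomial_eq_0)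
    then show ?case by simp
  next
    case (Suc x)
    let ?P = "\<lambda>R. \<Sum>r<R. of_nat (x choose r) * w ^ r"
    have "(\<Sum>r<R. of_nat (Suc x choose r) * w ^ r) = ?P R + w * ?P q"
      unfolding \<open>R = Suc q\<close> sum.lessThan_Suc_shift
      by (simp add: sum_distrib_left sum.distrib algebra_simps)
    also have "\<dots> = (1 + w) * ?P R - of_nat (x choose q) * w ^ R"
      unfolding \<open>R = Suc q\<close> by (simp add: algebra_simps)
    finally have "(1 + w) ^ Suc x - (\<Sum>r<R. of_nat (Suc x choose r) * w ^ r) =
       (1 + w) * ((1 + w) ^ x - ?P R) + of_nat (x choose q) * w ^ R"
      by (simp add: algebra_simps)
    also have "norm \<dots> \<le> norm (1 + w) * norm ((1 + w) ^ x - ?P R) + real (x choose q) * norm w ^ R"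
      by (rule order.trans[OF norm_triangle_ineq]) (simp add: norm_mult norm_power)
    also have "\<dots> \<le> 1 * (real (x choose R) * norm w ^ R) + real (x choose q) * norm w ^ R"
      using Suc.IH assms by (intro add_mono mult_mono) auto
    also have "\<dots> = real (Suc x choose R) * norm w ^ R"
      unfolding \<open>R = Suc q\<close> by (simp add: algebra_simps)
    finally show ?case .
  qed
qed

text \<open>A fixed large \<open>R\<close> makes both \<open>norm w ^ R / fact R\<close> and the
  tail of the exponential series small; then only finitely many moments have to converge.\<close>

lemma factorial_moment_method:
  fixes \<phi> :: "nat \<Rightarrow> complex" and f :: "nat \<Rightarrow> nat \<Rightarrow> real"
  assumes f: "\<And>r. (\<lambda>k. f k r) \<longlonglongrightarrow> 1 / fact r"
    and \<phi>: "\<And>k R. norm (\<phi> k - (\<Sum>r<R. of_real (f k r) * w ^ r)) \<le> f k R * norm w ^ R"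
  shows "\<phi> \<longlonglongrightarrow> exp w"
proof (rule LIMSEQ_I)
  fix e :: real assume e: "e > 0"
  have "(\<lambda>R. norm w ^ R / fact R) \<longlonglongrightarrow> 0"
    using summable_LIMSEQ_zero[OF summable_exp[of "norm w"]] by (simp add: divide_inverse mult.commute)
  from LIMSEQ_D[OF this, of "e / 3"] e obtain R1 where R1: "\<And>R. R \<ge> R1 \<Longrightarrow> norm w ^ R / fact R < e / 3"
    by auto
  have "(\<lambda>R. \<Sum>r<R. w ^ r /\<^sub>R fact r) \<longlonglongrightarrow> exp w"
    using exp_converges[of w] by (simp add: sums_def)
  from LIMSEQ_D[OF this, of "e / 3"] e obtain R2 where
    R2: "\<And>R. R \<ge> R2 \<Longrightarrow> norm ((\<Sum>r<R. w ^ r /\<^sub>R fact r) - exp w) < e / 3" by auto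
  define R where "R = max R1 R2"
  let ?P = "\<Sum>r<R. w ^ r /\<^sub>R fact r"
  have "(\<lambda>k. f k R * norm w ^ R + norm ((\<Sum>r<R. of_real (f k r) * w ^ r) - ?P)) \<longlonglongrightarrow>
      1 / fact R * norm w ^ R + norm ((\<Sum>r<R. of_real (1 / fact r) * w ^ r) - ?P)"
    by (intro tendsto_intros f)
  also have "(\<Sum>r<R. of_real (1 / fact r) * w ^ r) = ?P"
    by (intro sum.cong refl) (simp add: scaleR_conv_of_real field_simps)
  finally have "(\<lambda>k. f k R * norm w ^ R + norm ((\<Sum>r<R. of_real (f k r) * w ^ r) - ?P)) \<longlonglongrightarrow>
      norm w ^ R / fact R" by simp
  moreover have "norm w ^ R / fact R < e / 3" by (rule R1) (simp add: R_def)
  ultimately have "\<forall>\<^sub>F k in sequentially.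
      f k R * norm w ^ R + norm ((\<Sum>r<R. of_real (f k r) * w ^ r) - ?P) < e / 3"
    by (rule order_tendstoD(2))
  then have "\<forall>\<^sub>F k in sequentially. norm (\<phi> k - exp w) < e"
  proof eventually_elim
    case (elim k)
    have "norm (\<phi> k - exp w) \<le> norm (\<phi> k - (\<Sum>r<R. of_real (f k r) * w ^ r)) +
        norm ((\<Sum>r<R. of_real (f k r) * w ^ r) - ?P) + norm (?P - exp w)"
      by norm
    with \<phi>[of k R] elim R2[of R] e show ?case by (simp add: R_def)
  qed
  then show "\<exists>no. \<forall>k\<ge>no. norm (\<phi> k - exp w) < e"
    by (simp add: eventually_sequentially)
qed

section \<open>Characteristic functions of the two laws\<close>

lemma char_distr_pmf:
  fixes X :: "'a \<Rightarrow> nat"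
  shows "char (distr (measure_pmf p) borel (\<lambda>t. real (X t))) s = (CLINT t|measure_pmf p. iexp s ^ X t)"
proof -
  have "iexp (s * real m) = iexp s ^ m" for m
    by (simp add: exp_of_nat_mult[symmetric] mult_ac)
  then show ?thesis
    unfolding char_def by (subst integral_distr) auto
qed

lemma char_poisson:
  assumes "rate > 0"
  shows "char (distr (measure_pmf (poisson_pmf rate)) borel real) s = exp (of_real rate * (iexp s - 1))"
proof -
  let ?g = "\<lambda>n. pmf (poisson_pmf rate) n *\<^sub>R iexp s ^ n"
  \<comment> \<open>Since \<open>iexp s\<close> has norm 1, the probabilities dominate the
    summands.\<close>
  have int: "integrable (count_space UNIV) ?g"
  proof (rule Bochner_Integration.integrable_bound)
    show "integrable (count_space UNIV) (pmf (poisson_pmf rate))" by (rule integrable_pmf)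
  qed (auto simp: norm_power)
  have "char (distr (measure_pmf (poisson_pmf rate)) borel real) s = (CLINT n|measure_pmf (poisson_pmf rate). iexp s ^ n)"
    using char_distr_pmf[of "poisson_pmf rate" "\<lambda>n. n"] by simp
  also have "\<dots> = (CLINT n|count_space UNIV. ?g n)"
    unfolding measure_pmf_eq_density by (subst integral_density) auto
  also have "\<dots> = (\<Sum>n. ?g n)"
    by (rule integral_count_space_nat[OF int])
  also have "\<dots> = exp (- of_real rate) * exp (of_real rate * iexp s)"
  proof (rule sums_unique[symmetric])
    have "(\<lambda>n. exp (- of_real rate) * ((of_real rate * iexp s) ^ n /\<^sub>R fact n)) sums
        (exp (- of_real rate) * exp (of_real rate * iexp s))"
      by (intro sums_mult exp_converges)
    also have "(\<lambda>n. exp (- of_real rate) * ((of_real rate * iexp s) ^ n /\<^sub>R fact n)) = ?g"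
      using assms by (auto simp: fun_eq_iff scaleR_conv_of_real power_mult_distrib exp_of_real[symmetric]
          divide_inverse mult_ac)
    finally show "?g sums (exp (- of_real rate) * exp (of_real rate * iexp s))" .
  qed
  also have "\<dots> = exp (of_real rate * (iexp s - 1))"
    by (simp add: exp_add[symmetric] algebra_simps)
  finally show ?thesis .
qed

text \<open>With \<open>w = iexp s - 1\<close> the number \<open>1 + w\<close> lies on the unit
  circle, so the remainder bound holds for every term; averaging it yields the normalised binomial
  moments.\<close>

lemma char_id_subterms_tendsto:
  "(\<lambda>k. char (distr (measure_pmf (pmf_of_set (closed_linear_terms (3 * k + 2)))) borel
      (\<lambda>t. real (id_subterms t))) s) \<longlonglongrightarrow> exp (iexp s - 1)"
proof (rule factorial_moment_method)
  show "(\<lambda>k. id_moment k r / term_count k) \<longlonglongrightarrow> 1 / fact r" for r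
    by (rule id_moment_ratio_tendsto)
next
  fix k R
  let ?S = "closed_linear_terms (3 * k + 2)" and ?w = "iexp s - 1"
  let ?P = "\<lambda>t. \<Sum>r<R. of_nat (id_subterms t choose r) * ?w ^ r"
  have card: "term_count k = real (card ?S)" by (simp add: id_moment_def)
  have "char (distr (measure_pmf (pmf_of_set ?S)) borel (\<lambda>t. real (id_subterms t))) s =
      (\<Sum>t\<in>?S. iexp s ^ id_subterms t) / of_nat (card ?S)"
    unfolding char_distr_pmf
    by (subst integral_measure_pmf[of ?S])
       (use closed_linear_terms_nonempty[of k] finite_closed_linear_terms[of "3 * k + 2"] in
         \<open>auto simp: scaleR_conv_of_real sum_divide_distrib\<close>)
  moreover have "(\<Sum>r<R. of_real (id_moment k r / term_count k) * ?w ^ r) = (\<Sum>t\<in>?S. ?P t) / of_nat (card ?S)"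
    unfolding card
    by (subst sum.swap) (simp add: id_moment_def sum_divide_distrib sum_distrib_right)
  ultimately have "norm (char (distr (measure_pmf (pmf_of_set ?S)) borel (\<lambda>t. real (id_subterms t))) s -
      (\<Sum>r<R. of_real (id_moment k r / term_count k) * ?w ^ r)) =
      norm (\<Sum>t\<in>?S. iexp s ^ id_subterms t - ?P t) / real (card ?S)"
    by (simp add: sum_subtractf norm_divide flip: diff_divide_distrib)
  also have "\<dots> \<le> (\<Sum>t\<in>?S. real (id_subterms t choose R) * norm ?w ^ R) / real (card ?S)"
    using binomial_remainder[of ?w _ R]
    by (intro divide_right_mono sum_norm_le) auto
  also have "\<dots> = id_moment k R / term_count k * norm ?w ^ R"
    unfolding card by (simp add: id_moment_def sum_distrib_right)
  finally show "norm (char (distr (measure_pmf (pmf_of_set ?S)) borel (\<lambda>t. real (id_subterms t))) s -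
      (\<Sum>r<R. of_real (id_moment k r / term_count k) * ?w ^ r)) \<le> id_moment k R / term_count k * norm ?w ^ R" .
qed

theorem mainTheorem1:
  "weak_conv_m
     (\<lambda>k. distr (measure_pmf (pmf_of_set (closed_linear_terms (3 * k + 2)))) borel
            (\<lambda>t. real (id_subterms t)))
     (distr (measure_pmf (poisson_pmf 1)) borel real)"
proof (rule levy_continuity)
  show "real_distribution (distr (measure_pmf (pmf_of_set (closed_linear_terms (3 * k + 2)))) borel
            (\<lambda>t. real (id_subterms t)))" for k
    by (simp add: real_distribution_def real_distribution_axioms_def measure_pmf.prob_space_distr)
  show "real_distribution (distr (measure_pmf (poisson_pmf 1)) borel real)"
    by (simp add: real_distribution_def real_distribution_axioms_def measure_pmf.prob_space_distr)
  show "(\<lambda>k. char (distr (measure_pmf (pmf_of_set (closed_linear_terms (3 * k + 2)))) borel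
      (\<lambda>t. real (id_subterms t))) s) \<longlonglongrightarrow> char (distr (measure_pmf (poisson_pmf 1)) borel real) s" for s
    using char_id_subterms_tendsto[of s] by (simp add: char_poisson)
qed

end
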